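(* For a positive integer $n$, set $$\mathcal{L}_{\mathcal{A}, n}(t):=\pounds^{\mathrm{OY}}_{\mathcal{A}, \{1\}^n}(t)-\frac{1}{n!}\sum_{k=1}^n(k-1)!\,\bigl(f_k(t)+g_k(t)\bigr)\,\pounds^{\mathrm{OY}}_{\mathcal{A}, 1}(t)^{n-k}\in\mathcal{A}_{\mathbb{Z}[t]}.$$ Then for every positive integer $n$, $$\mathcal{L}_{\mathcal{A}, n}(t)=\mathcal{L}_{\mathcal{A}, n}(1-t)$$ in $\mathcal{A}_{\mathbb{Z}[t]}$.
   Context: Let $\mathcal{A}_{\mathbb{Z}[t]}:=\bigl(\prod_p (\mathbb{Z}/p\mathbb{Z})[t]\bigr)/\bigl(\bigoplus_p (\mathbb{Z}/p\mathbb{Z})[t]\bigr)$ and $\mathcal{A}:=\bigl(\prod_p \mathbb{Z}/p\mathbb{Z}\bigr)/\bigl(\bigoplus_p \mathbb{Z}/p\mathbb{Z}\bigr)$, where $p$ runs over all primes. These are $\mathbb{Q}$-algebras, and $\mathcal{A}\subset\mathcal{A}_{\mathbb{Z}[t]}$ via constant polynomials. An element is represented by a family $(f_p)_p$; two families represent the same element if and only if $f_p=g_p$ for all but finitely many primes $p$. For $i\ge 1$, $t^{i\boldsymbol{p}}$ denotes the class of $(t^{ip} \bmod p)_p$. For $F(t)=(F_p(t))_p\in\mathcal{A}_{\mathbb{Z}[t]}$, $F(1-t)$ denotes the class of $(F_p(1-t))_p$. For $r\ge1$ and an index $\mathbf{k}=(k_1,\ldots,k_r)\in(\mathbb{Z}_{\ge1})^r$,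 the finite multiple polylogarithm of Ono--Yamamoto type is the element of $\mathcal{A}_{\mathbb{Z}[t]}$ whose $p$-component is $$\pounds^{\mathrm{OY}}_{\mathcal{A},\mathbf{k}}(t):=\sum'_{0<l_1,\ldots,l_r<p}\frac{t^{l_1+\cdots+l_r}}{l_1^{k_1}(l_1+l_2)^{k_2}\cdots(l_1+\cdots+l_r)^{k_r}} \bmod p,$$ where $\sum'$ means that the sum is only over the terms whose denominators are prime to $p$. For the empty index, $\pounds^{\mathrm{OY}}_{\mathcal{A},\emptyset}(t):=1$. For an index $\mathbf{k}=(k_1,\ldots,k_r)$ and $1\le i\le r$, define the element of $\mathcal{A}$ $$\zeta^{(i)}_{\mathcal{A}}(\mathbf{k}):=\sum'_{\substack{0<l_1,\ldots,l_r<p\\ (i-1)p<l_1+\cdots+l_r<ip}}\frac{1}{l_1^{k_1}(l_1+l_2)^{k_2}\cdots(l_1+\cdots+l_r)^{k_r}} \bmod p,$$ with the same meaning of $\sum'$. $\{1\}^n$ denotes $1,\ldots,1$ ($n$ times), with $\{1\}^0$ empty; $\pounds^{\mathrm{OY}}_{\mathcal{A},1}(t)$ is the case of the index $(1)$. For a positive integer $n$, define $$f_n(t):=\sum_{k=0}^{n-2}\left(\sum_{i=1}^{n-k-1}\zeta^{(i)}_{\mathcal{A}}(\{1\}^{n-k-2}, 2)\,t^{i\boldsymbol{p}}\right)\pounds^{\mathrm{OY}}_{\mathcal{A}, \{1\}^k}(t),$$ $$g_n(t):=\sum_{k=0}^{n-2}\left(\sum_{i=1}^{n-k-2}\zeta^{(i)}_{\mathcal{A}}(\{1\}^{n-k-2})\,t^{i\boldsymbol{p}}\right)\pounds^{\mathrm{OY}}_{\mathcal{A},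 (2, \{1\}^k)}(t),$$ where empty sums are $0$. *)

theory Defs
  imports "HOL-Computational_Algebra.Computational_Algebra" "HOL-Number_Theory.Modular_Inverse"
begin

text \<open>
  For a commutative ring \<open>R\<close>, the type \<open>R large_mod\<close> is
  \<open>(\<Prod>p. R/pR) / (\<Oplus>p. R/pR)\<close> with \<open>p\<close> running over all primes. A family of residue classes is
  represented by a family of elements of \<open>R\<close>; two families are identified iff they agree modulo
  \<open>p\<close> for all but finitely many primes \<open>p\<close> (values at non-primes are irrelevant).
  Thus \<open>int large_mod\<close> is \<open>\<A>\<close>, and \<open>int poly large_mod\<close> is \<open>\<A>\<^bsub>\<int>[t]\<^esub>\<close>, since
  \<open>\<int>[t]/p\<int>[t] = (\<int>/p\<int>)[t]\<close>.
\<close>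

definition large_mod_rel :: "(nat \<Rightarrow> 'a::comm_ring_1) \<Rightarrow> (nat \<Rightarrow> 'a) \<Rightarrow> bool" where
  "large_mod_rel f g \<longleftrightarrow> finite {p. prime p \<and> \<not> of_nat p dvd f p - g p}"

lemma large_mod_rel_lift:
  assumes "large_mod_rel f f'" "large_mod_rel g g'"
    and "\<And>p. prime p \<Longrightarrow> of_nat p dvd f p - f' p \<Longrightarrow> of_nat p dvd g p - g' p
           \<Longrightarrow> of_nat p dvd h p - h' p"
  shows "large_mod_rel h h'"
proof -
  have "{p. prime p \<and> \<not> of_nat p dvd h p - h' p} \<subseteq>
      {p. prime p \<and> \<not> of_nat p dvd f p - f' p} \<union> {p. prime p \<and> \<not> of_nat p dvd g p - g' p}"
    using assms(3) by blast
  then show ?thesis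
    using assms(1,2) unfolding large_mod_rel_def by (meson finite_UnI finite_subset)
qed

lemma large_mod_rel_refl: "large_mod_rel f f"
  by (simp add: large_mod_rel_def)

lemma equivp_large_mod_rel: "equivp (large_mod_rel :: (nat \<Rightarrow> 'a::comm_ring_1) \<Rightarrow> _)"
proof (rule equivpI)
  show "reflp (large_mod_rel :: (nat \<Rightarrow> 'a) \<Rightarrow> _)"
    by (simp add: reflp_def large_mod_rel_refl)
  show "symp (large_mod_rel :: (nat \<Rightarrow> 'a) \<Rightarrow> _)"
  proof (rule sympI)
    fix f g :: "nat \<Rightarrow> 'a"
    assume fg: "large_mod_rel f g"
    show "large_mod_rel g f"
    proof (rule large_mod_rel_lift[OF fg fg])
      fix p :: nat
      assume "of_nat p dvd f p - g p"
      then have "of_nat p dvd - (f p - g p)" by (simp only: dvd_minus_iff)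
      then show "of_nat p dvd g p - f p" by simp
    qed
  qed
  show "transp (large_mod_rel :: (nat \<Rightarrow> 'a) \<Rightarrow> _)"
  proof (rule transpI)
    fix f g h :: "nat \<Rightarrow> 'a"
    assume "large_mod_rel f g" "large_mod_rel g h"
    then show "large_mod_rel f h"
    proof (rule large_mod_rel_lift)
      fix p :: nat
      assume "of_nat p dvd f p - g p" "of_nat p dvd g p - h p"
      then have "of_nat p dvd (f p - g p) + (g p - h p)" by (rule dvd_add)
      then show "of_nat p dvd f p - h p" by simp
    qed
  qed
qed

quotient_type (overloaded) 'a large_mod = "nat \<Rightarrow> 'a::comm_ring_1" / large_mod_rel
  by (rule equivp_large_mod_rel)

instantiation large_mod :: (comm_ring_1) "{comm_ring, comm_monoid_mult}"
begin

lift_definition zero_large_mod :: "'a large_mod" is "\<lambda>p. 0" .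

lift_definition one_large_mod :: "'a large_mod" is "\<lambda>p. 1" .

lift_definition plus_large_mod :: "'a large_mod \<Rightarrow> 'a large_mod \<Rightarrow> 'a large_mod"
  is "\<lambda>f g p. f p + g p"
proof (erule (1) large_mod_rel_lift)
  fix f f' g g' :: "nat \<Rightarrow> 'a" and p :: nat
  assume "of_nat p dvd f p - f' p" "of_nat p dvd g p - g' p"
  then have "of_nat p dvd (f p - f' p) + (g p - g' p)" by (rule dvd_add)
  then show "of_nat p dvd (f p + g p) - (f' p + g' p)" by (simp add: algebra_simps)
qed

lift_definition uminus_large_mod :: "'a large_mod \<Rightarrow> 'a large_mod" is "\<lambda>f p. - f p"
proof (rule large_mod_rel_lift, assumption, assumption)
  fix f f' :: "nat \<Rightarrow> 'a" and p :: nat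
  assume "of_nat p dvd f p - f' p"
  then have "of_nat p dvd - (f p - f' p)" by (simp only: dvd_minus_iff)
  then show "of_nat p dvd - f p - - f' p" by simp
qed

lift_definition minus_large_mod :: "'a large_mod \<Rightarrow> 'a large_mod \<Rightarrow> 'a large_mod"
  is "\<lambda>f g p. f p - g p"
proof (erule (1) large_mod_rel_lift)
  fix f f' g g' :: "nat \<Rightarrow> 'a" and p :: nat
  assume "of_nat p dvd f p - f' p" "of_nat p dvd g p - g' p"
  then have "of_nat p dvd (f p - f' p) - (g p - g' p)" by (rule dvd_diff)
  then show "of_nat p dvd (f p - g p) - (f' p - g' p)" by (simp add: algebra_simps)
qed

lift_definition times_large_mod :: "'a large_mod \<Rightarrow> 'a large_mod \<Rightarrow> 'a large_mod"
  is "\<lambda>f g p. f p * g p"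
proof (erule (1) large_mod_rel_lift)
  fix f f' g g' :: "nat \<Rightarrow> 'a" and p :: nat
  assume "of_nat p dvd f p - f' p" "of_nat p dvd g p - g' p"
  then have "of_nat p dvd (f p - f' p) * g p + f' p * (g p - g' p)"
    by (intro dvd_add dvd_mult2 dvd_mult)
  then show "of_nat p dvd f p * g p - f' p * g' p" by (simp add: algebra_simps)
qed

instance
  by standard (transfer; simp add: large_mod_rel_refl algebra_simps)+

end

text \<open>
  The \<open>\<rat>\<close>-algebra structure: \<open>q\<close> acts on the \<open>p\<close>-component through its residue modulo \<open>p\<close>, which
  makes sense for all primes \<open>p\<close> not dividing the denominator of \<open>q\<close>, i.e. for almost all \<open>p\<close>.
\<close>

definition rat_residue :: "nat \<Rightarrow> rat \<Rightarrow> int" where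
  "rat_residue p q = fst (quotient_of q) * modular_inverse (int p) (snd (quotient_of q))"

lift_definition scaleQ :: "rat \<Rightarrow> 'a::comm_ring_1 large_mod \<Rightarrow> 'a large_mod" (infixr \<open>*\<^sub>Q\<close> 75)
  is "\<lambda>q f p. of_int (rat_residue p q) * f p"
  by (rule large_mod_rel_lift, assumption, assumption) (simp flip: right_diff_distrib)

lemma rat_residue_cong:
  assumes p: "prime p" "\<not> int p dvd snd (quotient_of q)" and q: "q * of_int b = of_int a"
  shows "[rat_residue p q * b = a] (mod int p)"
proof -
  obtain n d where nd: "quotient_of q = (n, d)" by force
  then have d: "d > 0" "q = of_int n / of_int d"
    by (auto simp: quotient_of_denom_pos quotient_of_div)
  have cop: "coprime d (int p)"
    using p nd by (simp add: coprime_commute[of d] prime_imp_coprime)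
  have "(of_int (n * b) :: rat) = of_int (a * d)"
    using q d by (simp add: field_simps)
  then have nb: "n * b = a * d" by (simp only: of_int_eq_iff)
  have "[(n * b) * modular_inverse (int p) d = a * (d * modular_inverse (int p) d)] (mod int p)"
    unfolding nb by (simp add: mult.assoc)
  also have "[a * (d * modular_inverse (int p) d) = a * 1] (mod int p)"
    by (intro cong_mult cong_refl cong_modular_inverse1 cop)
  finally show ?thesis
    by (simp add: rat_residue_def nd mult_ac)
qed

lemma finite_prime_divisors_denom: "finite {p. prime p \<and> int p dvd snd (quotient_of q)}"
proof -
  have "snd (quotient_of q) > 0" by (simp add: quotient_of_denom_pos')
  then have "finite {p. p dvd nat (snd (quotient_of q))}" by (intro finite_divisors_nat) auto
  then show ?thesis
    by (rule rev_finite_subset)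
      (use \<open>snd (quotient_of q) > 0\<close> in \<open>auto simp: int_dvd_int_iff[symmetric]\<close>)
qed

lemma of_nat_dvd_of_int_times:
  assumes "[x = y] (mod int p)"
  shows "of_nat p dvd (of_int x * z - of_int y * z :: 'a::comm_ring_1)"
proof -
  from assms obtain k where "x - y = int p * k" by (auto simp: cong_iff_dvd_diff)
  then have "(of_int x - of_int y :: 'a) = of_nat p * of_int k"
    by (metis of_int_diff of_int_mult of_int_of_nat_eq)
  then show ?thesis by (simp add: mult.assoc flip: left_diff_distrib)
qed

lemma large_mod_rel_residueI:
  assumes "finite S" "\<And>p. prime p \<Longrightarrow> p \<notin> S \<Longrightarrow> [x p = y p] (mod int p)"
  shows "large_mod_rel (\<lambda>p. of_int (x p) * f p) (\<lambda>p. of_int (y p) * f p)"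
  unfolding large_mod_rel_def
  by (rule finite_subset[OF _ assms(1)]) (use assms(2) of_nat_dvd_of_int_times in blast)

lemma rat_residue_cong_denom:
  assumes "prime p" "\<not> int p dvd snd (quotient_of q)"
  shows "[rat_residue p q * snd (quotient_of q) = fst (quotient_of q)] (mod int p)"
  by (rule rat_residue_cong[OF assms])
    (use quotient_of_denom_pos'[of q] quotient_of_div[of q, OF prod.collapse[symmetric]]
      in \<open>simp add: field_simps\<close>)

lemma rat_eq_quotient: "q * of_int (snd (quotient_of q)) = of_int (fst (quotient_of q))"
  using quotient_of_denom_pos'[of q] quotient_of_div[of q, OF prod.collapse[symmetric]]
  by (metis less_irrefl nonzero_divide_eq_eq of_int_eq_0_iff)

lemma scaleQ_add_left: "(q + r) *\<^sub>Q x = q *\<^sub>Q x + r *\<^sub>Q x"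
proof transfer
  fix q r and f :: "nat \<Rightarrow> 'a"
  let ?d = "\<lambda>q. snd (quotient_of q)" and ?n = "\<lambda>q. fst (quotient_of q)"
  let ?S = "\<lambda>q. {p. prime p \<and> int p dvd ?d q}"
  have "large_mod_rel (\<lambda>p. of_int (rat_residue p (q + r)) * f p)
     (\<lambda>p. of_int (rat_residue p q + rat_residue p r) * f p)"
  proof (rule large_mod_rel_residueI)
    show "finite (?S q \<union> ?S r \<union> ?S (q + r))" by (simp add: finite_prime_divisors_denom)
    fix p assume p: "prime p" "p \<notin> ?S q \<union> ?S r \<union> ?S (q + r)"
    let ?b = "?d q * ?d r" and ?a = "?n q * ?d r + ?n r * ?d q"
    have "(q + r) * of_int ?b = (q * of_int (?d q)) * of_int (?d r) + (r * of_int (?d r)) * of_int (?d q)"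
      by (simp add: algebra_simps)
    then have "(q + r) * of_int ?b = of_int ?a" by (simp only: rat_eq_quotient) simp
    then have 1: "[rat_residue p (q + r) * ?b = ?a] (mod int p)"
      using p by (intro rat_residue_cong) auto
    have "[(rat_residue p q * ?d q) * ?d r + (rat_residue p r * ?d r) * ?d q = ?a] (mod int p)"
      using p by (intro cong_add cong_mult cong_refl rat_residue_cong_denom) auto
    then have "[(rat_residue p q + rat_residue p r) * ?b = ?a] (mod int p)"
      by (simp add: algebra_simps)
    with 1 have "[rat_residue p (q + r) * ?b = (rat_residue p q + rat_residue p r) * ?b] (mod int p)"
      using cong_sym cong_trans by blast
    moreover have "coprime ?b (int p)"
      using p by (auto simp: coprime_commute prime_imp_coprime)
    ultimately show "[rat_residue p (q + r) = rat_residue p q + rat_residue p r] (mod int p)"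
      by (simp add: cong_mult_rcancel)
  qed
  then show "large_mod_rel (\<lambda>p. of_int (rat_residue p (q + r)) * f p)
     (\<lambda>p. of_int (rat_residue p q) * f p + of_int (rat_residue p r) * f p)"
    by (simp add: distrib_right)
qed

lemma scaleQ_assoc: "q *\<^sub>Q r *\<^sub>Q x = (q * r) *\<^sub>Q x"
proof transfer
  fix q r and f :: "nat \<Rightarrow> 'a"
  let ?d = "\<lambda>q. snd (quotient_of q)" and ?n = "\<lambda>q. fst (quotient_of q)"
  let ?S = "\<lambda>q. {p. prime p \<and> int p dvd ?d q}"
  have "large_mod_rel (\<lambda>p. of_int (rat_residue p q * rat_residue p r) * f p)
     (\<lambda>p. of_int (rat_residue p (q * r)) * f p)"
  proof (rule large_mod_rel_residueI)
    show "finite (?S q \<union> ?S r \<union> ?S (q * r))" by (simp add: finite_prime_divisors_denom)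
    fix p assume p: "prime p" "p \<notin> ?S q \<union> ?S r \<union> ?S (q * r)"
    let ?b = "?d q * ?d r" and ?a = "?n q * ?n r"
    have "(q * r) * of_int ?b = (q * of_int (?d q)) * (r * of_int (?d r))"
      by (simp add: algebra_simps)
    then have "(q * r) * of_int ?b = of_int ?a" by (simp only: rat_eq_quotient) simp
    then have 1: "[rat_residue p (q * r) * ?b = ?a] (mod int p)"
      using p by (intro rat_residue_cong) auto
    have "[(rat_residue p q * ?d q) * (rat_residue p r * ?d r) = ?a] (mod int p)"
      using p by (intro cong_mult rat_residue_cong_denom) auto
    then have "[(rat_residue p q * rat_residue p r) * ?b = ?a] (mod int p)"
      by (simp add: algebra_simps)
    with 1 have "[(rat_residue p q * rat_residue p r) * ?b = rat_residue p (q * r) * ?b] (mod int p)"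
      using cong_sym cong_trans by blast
    moreover have "coprime ?b (int p)"
      using p by (auto simp: coprime_commute prime_imp_coprime)
    ultimately show "[rat_residue p q * rat_residue p r = rat_residue p (q * r)] (mod int p)"
      by (simp add: cong_mult_rcancel)
  qed
  then show "large_mod_rel (\<lambda>p. of_int (rat_residue p q) * (of_int (rat_residue p r) * f p))
     (\<lambda>p. of_int (rat_residue p (q * r)) * f p)"
    by (simp add: mult.assoc)
qed

lemma scaleQ_one: "1 *\<^sub>Q x = x"
proof transfer
  fix f :: "nat \<Rightarrow> 'a"
  have "large_mod_rel (\<lambda>p. of_int (rat_residue p 1) * f p) (\<lambda>p. of_int 1 * f p)"
    by (rule large_mod_rel_residueI[of "{}"])
      (use prime_gt_1_nat in \<open>auto simp: rat_residue_def\<close>)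
  then show "large_mod_rel (\<lambda>p. of_int (rat_residue p 1) * f p) f" by simp
qed

lemma scaleQ_add_right: "q *\<^sub>Q (x + y) = q *\<^sub>Q x + q *\<^sub>Q y"
  by transfer (simp add: distrib_left large_mod_rel_refl)

lemma vector_space_scaleQ: "vector_space scaleQ"
  by unfold_locales (simp_all add: scaleQ_add_left scaleQ_assoc scaleQ_one scaleQ_add_right)

lemma scaleQ_mult_left: "(q *\<^sub>Q x) * y = q *\<^sub>Q (x * y)"
  by transfer (simp add: mult.assoc large_mod_rel_refl)

text \<open>The inclusion of \<open>\<A>\<close> into \<open>\<A>\<^bsub>\<int>[t]\<^esub>\<close> by constant polynomials.\<close>

lift_definition const_A :: "int large_mod \<Rightarrow> int poly large_mod" is "\<lambda>f p. [:f p:]"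
  by (simp add: large_mod_rel_def of_nat_poly)

lemma const_A_inject: "const_A x = const_A y \<longleftrightarrow> x = y"
  by transfer (simp add: large_mod_rel_def of_nat_poly)

text \<open>The class of \<open>t\<^bsup>ip\<^esup>\<close>.\<close>

lift_definition t_pow_p :: "nat \<Rightarrow> int poly large_mod" is "\<lambda>i p. monom 1 (i * p)" .

text \<open>The substitution \<open>F(t) \<mapsto> F(1 - t)\<close>.\<close>

lift_definition subst_one_minus :: "int poly large_mod \<Rightarrow> int poly large_mod"
  is "\<lambda>f p. f p \<circ>\<^sub>p [:1, -1:]"
proof -
  fix f g :: "nat \<Rightarrow> int poly"
  assume fg: "large_mod_rel f g"
  show "large_mod_rel (\<lambda>p. f p \<circ>\<^sub>p [:1, -1:]) (\<lambda>p. g p \<circ>\<^sub>p [:1, -1:])"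
  proof (rule large_mod_rel_lift[OF fg fg])
    fix p :: nat
    assume "of_nat p dvd f p - g p"
    then obtain h where "f p - g p = of_nat p * h" ..
    then have "(f p - g p) \<circ>\<^sub>p [:1, -1:] = of_nat p * (h \<circ>\<^sub>p [:1, -1:])"
      by (simp add: of_nat_mult_conv_smult pcompose_smult)
    then show "of_nat p dvd f p \<circ>\<^sub>p [:1, -1:] - g p \<circ>\<^sub>p [:1, -1:]"
      by (simp add: pcompose_diff)
  qed
qed

text \<open>
  An index is a list of positive integers. With 0-based list positions, \<open>oy_denom k l\<close> is
  \<open>l\<^sub>1\<^bsup>k\<^sub>1\<^esup> (l\<^sub>1 + l\<^sub>2)\<^bsup>k\<^sub>2\<^esup> \<cdots> (l\<^sub>1 + \<cdots> + l\<^sub>r)\<^bsup>k\<^sub>r\<^esup>\<close>, and \<open>oy_range k p\<close> is the set of tuples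
  \<open>0 < l\<^sub>1, \<dots>, l\<^sub>r < p\<close> for which this denominator is prime to \<open>p\<close>, i.e. the range of \<open>\<Sum>'\<close>.
\<close>

definition oy_denom :: "nat list \<Rightarrow> nat list \<Rightarrow> nat" where
  "oy_denom k l = (\<Prod>i<length k. (\<Sum>j\<le>i. l ! j) ^ (k ! i))"

definition oy_range :: "nat list \<Rightarrow> nat \<Rightarrow> nat list set" where
  "oy_range k p = {l. length l = length k \<and> set l \<subseteq> {0<..<p} \<and> coprime (oy_denom k l) p}"

text \<open>For the empty index this is \<open>1\<close>, from the empty tuple; see \<open>oy_polylog_Nil\<close>.\<close>

lift_definition oy_polylog :: "nat list \<Rightarrow> int poly large_mod"
  is "\<lambda>k p. \<Sum>l\<in>oy_range k p. monom (modular_inverse (int p) (int (oy_denom k l))) (sum_list l)" .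

lemma oy_polylog_Nil: "oy_polylog [] = 1"
proof transfer
  have "oy_range [] p = {[]}" for p by (auto simp: oy_range_def oy_denom_def)
  then have "{p. prime p \<and> \<not> of_nat p dvd (\<Sum>l\<in>oy_range [] p.
      monom (modular_inverse (int p) (int (oy_denom [] l))) (sum_list l)) - 1} = {}"
    using prime_gt_1_nat by (auto simp: oy_denom_def monom_0 pCons_one)
  then show "large_mod_rel (\<lambda>p. \<Sum>l\<in>oy_range [] p.
      monom (modular_inverse (int p) (int (oy_denom [] l))) (sum_list l)) (\<lambda>p. 1)"
    unfolding large_mod_rel_def by (simp only:) simp
qed

text \<open>\<open>\<zeta>\<^bsup>(i)\<^esup>\<close> is only used for \<open>1 \<le> i \<le> length k\<close>.\<close>

lift_definition zeta_A :: "nat \<Rightarrow> nat list \<Rightarrow> int large_mod"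
  is "\<lambda>i k p. \<Sum>l\<in>{l \<in> oy_range k p. (i - 1) * p < sum_list l \<and> sum_list l < i * p}.
                modular_inverse (int p) (int (oy_denom k l))" .

text \<open>
  The outer sums over \<open>0 \<le> k \<le> n - 2\<close> are written over \<open>k < n - 1\<close>, so that they are empty for
  \<open>n = 1\<close>. The truncated subtractions are then harmless.
\<close>

definition f_A :: "nat \<Rightarrow> int poly large_mod" where
  "f_A n = (\<Sum>k<n - 1.
     (\<Sum>i = 1..n - k - 1. const_A (zeta_A i (replicate (n - k - 2) 1 @ [2])) * t_pow_p i)
       * oy_polylog (replicate k 1))"

definition g_A :: "nat \<Rightarrow> int poly large_mod" where
  "g_A n = (\<Sum>k<n - 1.
     (\<Sum>i = 1..n - k - 2. const_A (zeta_A i (replicate (n - k - 2) 1)) * t_pow_p i)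
       * oy_polylog (2 # replicate k 1))"

definition L_A :: "nat \<Rightarrow> int poly large_mod" where
  "L_A n = oy_polylog (replicate n 1)
     - (1 / fact n) *\<^sub>Q (\<Sum>k = 1..n. fact (k - 1) *\<^sub>Q ((f_A k + g_A k) * oy_polylog [1] ^ (n - k)))"

end

theory Submission
  imports "HOL-Number_Theory.Residues" Defs
begin

text \<open>
  Write \<open>P\<^sub>n\<close> for the Ono--Yamamoto polylogarithm of the index \<open>1, \<dots>, 1\<close> of length \<open>n\<close>. The reason
  for the symmetry is that the correction terms in \<open>L_A n\<close> remove from \<open>P\<^sub>n\<close> everything except
  \<open>P\<^sub>1\<^sup>n / n!\<close> (lemma \<open>L_A_eq_power\<close>), and \<open>P\<^sub>1\<close> itself is invariant under \<open>t \<mapsto> 1 - t\<close>, being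
  the reduction of \<open>(1 - t\<^sup>p - (1 - t)\<^sup>p) / p\<close> (lemma \<open>subst_one_minus_oy_polylog_1\<close>).

  The first point follows by induction from the recurrence
  \<open>n P\<^sub>n = P\<^sub>1 P\<^bsub>n - 1\<^esub> + f\<^sub>n + g\<^sub>n\<close> (lemma \<open>oy_polylog_ones_recurrence\<close>), multiplied by \<open>(n - 1)!\<close>.
  To see the recurrence, think of a tuple \<open>(l\<^sub>1, \<dots>, l\<^bsub>n - 1\<^esub>)\<close> as a path starting at \<open>0\<close>, with
  partial sums \<open>s\<^sub>1, \<dots>, s\<^bsub>n - 1\<^esub>\<close> and weight \<open>1 / (s\<^sub>1 \<cdots> s\<^bsub>n - 1\<^esub>)\<close>. For rational numbers, inserting
  a further step \<open>m\<close> in all \<open>n\<close> possible positions and adding up the weights gives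
  \<open>(1/m) \<cdot> 1 / (s\<^sub>1 \<cdots> s\<^bsub>n - 1\<^esub>)\<close>, by induction from \<open>1/m + 1/s = (s + m) / (m s)\<close>. Summed over all
  \<open>m\<close> and all paths this would be \<open>n P\<^sub>n = P\<^sub>1 P\<^bsub>n - 1\<^esub>\<close>. Modulo \<open>p\<close>, with \<open>1/0\<close> read as \<open>0\<close>, the
  identity acquires one defect for each position at which \<open>s\<^sub>k\<close> or \<open>s\<^sub>k + m\<close> is divisible by \<open>p\<close>
  (lemma \<open>sum_path_weight_insert\<close>). At such a position the path is cut into two independent pieces:
  the piece before the cut ends at a multiple \<open>ip\<close> of \<open>p\<close> and yields a coefficient
  \<open>\<zeta>\<^bsup>(i)\<^esup> t\<^bsup>ip\<^esup>\<close>, the piece after it yields a polylogarithm (lemma \<open>sum_defect\<close>). Cuts with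
  \<open>s\<^sub>k + m \<equiv> 0\<close> add up to \<open>f\<^sub>n\<close> and those with \<open>s\<^sub>k \<equiv> 0\<close> to \<open>g\<^sub>n\<close>.
\<close>

section \<open>Inverses modulo a prime\<close>

text \<open>
  By Fermat's little theorem, \<open>x\<^bsup>p - 2\<^esup>\<close> represents the inverse of \<open>x\<close> modulo \<open>p\<close>. This
  representative is multiplicative on the nose, not merely up to congruence, and for \<open>p \<ge> 3\<close> it
  vanishes modulo \<open>p\<close> when \<open>p\<close> divides \<open>x\<close>. The sums restricted to denominators prime to \<open>p\<close>
  thereby become sums over all tuples.
\<close>

definition fermat_inv :: "nat \<Rightarrow> nat \<Rightarrow> int" where
  "fermat_inv p x = int x ^ (p - 2)"

lemma fermat_inv_mult: "fermat_inv p (x * y) = fermat_inv p x * fermat_inv p y"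
  by (simp add: fermat_inv_def power_mult_distrib)

lemma fermat_inv_one [simp]: "fermat_inv p 1 = 1" "fermat_inv p (Suc 0) = 1"
  by (simp_all add: fermat_inv_def)

lemma fermat_inv_eq_0:
  assumes "p \<ge> 3" "p dvd x"
  shows "[fermat_inv p x = 0] (mod int p)"
proof -
  have "int p dvd int x ^ (p - 2)"
    using assms by (intro dvd_power_le[where n = 1, simplified]) (auto dest: dvd_trans)
  then show ?thesis by (simp add: fermat_inv_def cong_0_iff)
qed

lemma fermat_inv_inverse:
  assumes "prime p" "p \<ge> 3" "\<not> p dvd x"
  shows "[int x * fermat_inv p x = 1] (mod int p)"
proof -
  have "[x ^ (p - 1) = 1] (mod p)" using assms by (intro fermat_theorem) auto
  then have "[int (x ^ (p - 1)) = int 1] (mod int p)" by (subst cong_int_iff)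
  moreover have "int x * fermat_inv p x = int (x ^ (p - 1))"
    using assms(2) by (simp add: fermat_inv_def flip: power_Suc)
       (simp add: Suc_diff_Suc eval_nat_numeral)
  ultimately show ?thesis by simp
qed

lemma fermat_inv_unique:
  assumes "prime p" "p \<ge> 3" "[int x * y = 1] (mod int p)"
  shows "[fermat_inv p x = y] (mod int p)"
proof -
  have "\<not> p dvd x"
  proof
    assume "p dvd x"
    then have "[0 = 1] (mod int p)"
      using assms(3) by (metis cong_0_iff cong_mult_self_left cong_sym cong_trans dvd_mult2 int_dvd_int_iff)
    then show False using assms(1) by (simp add: cong_0_1_nat prime_gt_1_nat cong_iff_dvd_diff)
  qed
  then have "[int x * fermat_inv p x = int x * y] (mod int p)"
    using fermat_inv_inverse[OF assms(1,2)] assms(3) cong_sym cong_trans by blast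
  moreover have "coprime (int x) (int p)"
    using \<open>\<not> p dvd x\<close> assms(1) by (simp add: coprime_commute prime_imp_coprime)
  ultimately show ?thesis by (simp add: cong_mult_lcancel)
qed

lemma fermat_inv_cong:
  assumes "[x = y] (mod p)"
  shows "[fermat_inv p x = fermat_inv p y] (mod int p)"
  unfolding fermat_inv_def using assms by (intro cong_pow) (simp add: cong_int_iff)

text \<open>
  For \<open>s\<close>, \<open>m\<close> and \<open>s + m\<close> invertible this is the partial fraction identity
  \<open>1/m \<cdot> 1/(s + m) + 1/s \<cdot> 1/(s + m) = 1/m \<cdot> 1/s\<close>. Since \<open>1/0\<close> counts as \<open>0\<close>, a term \<open>1/m\<^sup>2\<close> is
  left over if \<open>s \<equiv> 0\<close> and a term \<open>1/s\<^sup>2\<close> if \<open>s \<equiv> -m\<close>; these squares are the origin of the entries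
  \<open>2\<close> in the indices of \<open>f\<^sub>n\<close> and \<open>g\<^sub>n\<close>.
\<close>

lemma fermat_inv_partial_fractions:
  assumes p: "prime p" "p \<ge> 3" and m: "\<not> p dvd m"
  shows "[fermat_inv p m * fermat_inv p (s + m) + fermat_inv p s * fermat_inv p (s + m)
    = fermat_inv p m * fermat_inv p s + of_bool (p dvd s) * fermat_inv p m ^ 2
      + of_bool (p dvd s + m) * fermat_inv p s ^ 2] (mod int p)"
proof -
  let ?v = "fermat_inv p"
  consider "p dvd s" | "\<not> p dvd s" "p dvd s + m" | "\<not> p dvd s" "\<not> p dvd s + m" by blast
  then show ?thesis
  proof cases
    case 1
    then have 2: "\<not> p dvd s + m" using m by (simp add: dvd_add_right_iff)
    have sm: "[s + m = m] (mod p)" using 1 by (simp add: cong_def dvd_eq_mod_eq_0 mod_add_left_eq[symmetric, of s])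
    have "[?v m * ?v (s + m) + ?v s * ?v (s + m) = ?v m * ?v m + 0 * ?v (s + m)] (mod int p)"
      by (intro cong_add cong_mult cong_refl fermat_inv_cong sm fermat_inv_eq_0 p 1)
    moreover have "[?v m * ?v s + ?v m ^ 2 = ?v m * 0 + ?v m ^ 2] (mod int p)"
      by (intro cong_add cong_mult cong_refl fermat_inv_eq_0 p 1)
    ultimately show ?thesis using 1 2 by (simp add: power2_eq_square cong_def)
  next
    case 2
    have z: "[?v (s + m) = 0] (mod int p)" using 2 p by (simp add: fermat_inv_eq_0)
    have "[int s * - ?v m = 1] (mod int p)"
    proof -
      have "[int s = - int m] (mod int p)"
        using 2 by (simp add: cong_iff_dvd_diff flip: of_nat_add)
      then have "[int s * - ?v m = (- int m) * - ?v m] (mod int p)" by (intro cong_mult cong_refl)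
      then show ?thesis using fermat_inv_inverse[OF p m] by (simp add: cong_def)
    qed
    then have s: "[?v s = - ?v m] (mod int p)" by (rule fermat_inv_unique[OF p])
    have "[?v m * ?v (s + m) + ?v s * ?v (s + m) = ?v m * 0 + ?v s * 0] (mod int p)"
      by (intro cong_add cong_mult cong_refl z)
    moreover have "[?v m * ?v s + ?v s ^ 2 = ?v m * - ?v m + (- ?v m) ^ 2] (mod int p)"
      by (intro cong_add cong_mult cong_pow cong_refl s)
    ultimately show ?thesis using 2 by (simp add: power2_eq_square cong_def)
  next
    case 3
    have "[?v m * ?v (s + m) + ?v s * ?v (s + m)
       = (int s * ?v s) * (?v m * ?v (s + m)) + (int m * ?v m) * (?v s * ?v (s + m))] (mod int p)"
      using cong_add[OF cong_mult[OF fermat_inv_inverse[OF p 3(1)] cong_refl[of "?v m * ?v (s + m)"]]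
        cong_mult[OF fermat_inv_inverse[OF p m] cong_refl[of "?v s * ?v (s + m)"]]]
      by (simp add: cong_sym_eq)
    also have "(int s * ?v s) * (?v m * ?v (s + m)) + (int m * ?v m) * (?v s * ?v (s + m))
      = (int (s + m) * ?v (s + m)) * (?v m * ?v s)" by (simp add: algebra_simps)
    also have "[\<dots> = 1 * (?v m * ?v s)] (mod int p)"
      by (intro cong_mult cong_refl fermat_inv_inverse p 3)
    finally show ?thesis using 3 by simp
  qed
qed

section \<open>Weights of paths\<close>

text \<open>
  A list is read as the steps of a path. The starting point \<open>s\<close> is a parameter so that the weight of
  a path can be factored where the path is cut in two.
\<close>

fun path_denom :: "nat \<Rightarrow> nat list \<Rightarrow> nat" where
  "path_denom s [] = 1"
| "path_denom s (x # xs) = (s + x) * path_denom (s + x) xs"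

lemma path_denom_append: "path_denom s (xs @ ys) = path_denom s xs * path_denom (s + sum_list xs) ys"
  by (induction xs arbitrary: s) (simp_all add: add.assoc)

lemma path_denom_conv_prod: "(\<Prod>i<length l. s + (\<Sum>j\<le>i. l ! j)) = path_denom s l"
proof (induction l arbitrary: s)
  case (Cons x l)
  have "(\<Prod>i<length (x # l). s + (\<Sum>j\<le>i. (x # l) ! j)) = (s + x) * (\<Prod>i<length l. (s + x) + (\<Sum>j\<le>i. l ! j))"
    by (simp add: prod.lessThan_Suc_shift sum.atMost_Suc_shift add.assoc del: prod.lessThan_Suc sum.atMost_Suc)
  then show ?case using Cons.IH by simp
qed simp

lemma oy_denom_ones: "length l = n \<Longrightarrow> oy_denom (replicate n 1) l = path_denom 0 l"
  using path_denom_conv_prod[of 0 l] by (simp add: oy_denom_def)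

lemma sum_atMost_nth: "length l = Suc n \<Longrightarrow> (\<Sum>j\<le>n. l ! j) = (sum_list l :: nat)"
  by (simp add: sum_list_sum_nth atLeast0LessThan lessThan_Suc_atMost)

lemma oy_denom_ones_two:
  assumes "length l = Suc n"
  shows "oy_denom (replicate n 1 @ [2]) l = path_denom 0 l * sum_list l"
proof -
  have "path_denom 0 l = (\<Prod>i<n. \<Sum>j\<le>i. l ! j) * sum_list l"
    using path_denom_conv_prod[of 0 l] sum_atMost_nth[OF assms] by (simp add: assms)
  moreover have "oy_denom (replicate n 1 @ [2]) l = (\<Prod>i<n. \<Sum>j\<le>i. l ! j) * sum_list l ^ 2"
    using sum_atMost_nth[OF assms] by (simp add: oy_denom_def nth_append)
  ultimately show ?thesis by (simp add: power2_eq_square)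
qed

lemma oy_denom_two_ones:
  assumes "length l = n"
  shows "oy_denom (2 # replicate n 1) (m # l) = m ^ 2 * path_denom m l"
proof -
  have "oy_denom (2 # replicate n 1) (m # l) = m ^ 2 * (\<Prod>i<length l. m + (\<Sum>j\<le>i. l ! j))"
    using assms
    by (simp add: oy_denom_def prod.lessThan_Suc_shift sum.atMost_Suc_shift del: prod.lessThan_Suc sum.atMost_Suc)
  then show ?thesis by (simp only: path_denom_conv_prod)
qed

section \<open>Inserting a step into a path\<close>

abbreviation path_weight :: "nat \<Rightarrow> nat \<Rightarrow> nat list \<Rightarrow> int" where
  "path_weight p s l \<equiv> fermat_inv p (path_denom s l)"

text \<open>
  What is left over when the step \<open>m\<close> is inserted into \<open>l\<close> in all positions, contributed by the
  \<open>(q + 1)\<close>-st partial sum \<open>s\<close> of \<open>l\<close>. If \<open>s + m \<equiv> 0\<close>, the path restarts at \<open>0\<close> after \<open>q + 1\<close>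
  steps, and its first piece has its last denominator squared. If \<open>s \<equiv> 0\<close>, the first \<open>q\<close> steps
  form the first piece, and the second piece begins with the step \<open>m\<close>, whose denominator is squared.
\<close>

definition defect :: "nat \<Rightarrow> nat \<Rightarrow> nat list \<Rightarrow> nat \<Rightarrow> int" where
  "defect p m l q =
     of_bool (p dvd sum_list (take (Suc q) l) + m)
       * (path_weight p 0 (take (Suc q) l) * fermat_inv p (sum_list (take (Suc q) l))
          * path_weight p 0 (drop (Suc q) l))
     + of_bool (p dvd sum_list (take (Suc q) l))
       * (path_weight p 0 (take q l) * (fermat_inv p (m ^ 2) * path_weight p m (drop (Suc q) l)))"

text \<open>
  The second piece of the cut path is shorter than the full path by a multiple of \<open>p\<close>, so the new
  denominators agree modulo \<open>p\<close>.
\<close>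

lemma defect_snoc:
  assumes "q < length l"
  shows "[defect p m (l @ [x]) q = defect p m l q * fermat_inv p (sum_list l + x + m)] (mod int p)"
proof -
  let ?s = "sum_list (take (Suc q) l)" and ?d = "sum_list (drop (Suc q) l)" and ?v = "fermat_inv p"
  have s: "sum_list l = ?s + ?d" by (metis append_take_drop_id sum_list_append)
  have z: "[b = a + b] (mod p)" if "p dvd a" for a b
    using that by (auto simp: cong_def elim!: dvdE)
  have 1: "[of_bool (p dvd ?s + m) * ?v (?d + x) = of_bool (p dvd ?s + m) * ?v (sum_list l + x + m)] (mod int p)"
    using fermat_inv_cong[OF z[of "?s + m" "?d + x"]] unfolding s by (cases "p dvd ?s + m") (simp_all add: ac_simps)
  have 2: "[of_bool (p dvd ?s) * ?v (m + ?d + x) = of_bool (p dvd ?s) * ?v (sum_list l + x + m)] (mod int p)"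
    using fermat_inv_cong[OF z[of "?s" "m + ?d + x"]] unfolding s by (cases "p dvd ?s") (simp_all add: ac_simps)
  let ?a = "path_weight p 0 (take (Suc q) l) * ?v ?s * path_weight p 0 (drop (Suc q) l)"
  let ?b = "path_weight p 0 (take q l) * (?v (m ^ 2) * path_weight p m (drop (Suc q) l))"
  have lhs: "defect p m (l @ [x]) q = ?a * (of_bool (p dvd ?s + m) * ?v (?d + x)) + ?b * (of_bool (p dvd ?s) * ?v (m + ?d + x))"
    using assms by (simp add: defect_def path_denom_append fermat_inv_mult)
  have "[?a * (of_bool (p dvd ?s + m) * ?v (?d + x)) + ?b * (of_bool (p dvd ?s) * ?v (m + ?d + x))
     = ?a * (of_bool (p dvd ?s + m) * ?v (sum_list l + x + m))
       + ?b * (of_bool (p dvd ?s) * ?v (sum_list l + x + m))] (mod int p)"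
    by (intro cong_add cong_mult[OF cong_refl] 1 2)
  moreover have "?a * (of_bool (p dvd ?s + m) * ?v (sum_list l + x + m))
       + ?b * (of_bool (p dvd ?s) * ?v (sum_list l + x + m)) = defect p m l q * ?v (sum_list l + x + m)"
    by (simp add: defect_def algebra_simps)
  ultimately show ?thesis by (simp only: lhs)
qed

text \<open>
  Appending a step \<open>x\<close> to \<open>l\<close> multiplies all earlier insertions and all earlier defects by the
  inverse of \<open>s + m\<close>, where \<open>s\<close> is the new endpoint of the path, and creates one new insertion,
  behind \<open>x\<close>. The partial fraction identity absorbs the latter and produces the new defect.
\<close>

lemma sum_path_weight_insert:
  assumes p: "prime p" "p \<ge> 3" and m: "\<not> p dvd m"
  shows "[(\<Sum>j\<le>length l. path_weight p 0 (take j l @ m # drop j l))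
    = fermat_inv p m * path_weight p 0 l + (\<Sum>q<length l. defect p m l q)] (mod int p)"
proof (induction l rule: rev_induct)
  case Nil
  show ?case by simp
next
  case (snoc x l)
  let ?v = "fermat_inv p" and ?W = "path_weight p 0"
  define s where "s = sum_list l + x"
  have "(\<Sum>j\<le>length (l @ [x]). ?W (take j (l @ [x]) @ m # drop j (l @ [x])))
    = (\<Sum>j\<le>length l. ?W (take j l @ m # drop j l) * ?v (s + m)) + ?W l * (?v s * ?v (s + m))"
  proof -
    have "?W (take j (l @ [x]) @ m # drop j (l @ [x])) = ?W (take j l @ m # drop j l) * ?v (s + m)"
      if "j \<le> length l" for j
    proof -
      have "sum_list (take j l @ m # drop j l) = sum_list l + m"
        by (metis (no_types, lifting) append_take_drop_id sum_list_append sum_list.Cons add.commute add.left_commute)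
      then show ?thesis
        using that path_denom_append[of 0 "take j l @ m # drop j l" "[x]"]
        by (simp add: s_def fermat_inv_mult ac_simps)
    qed
    then have "(\<Sum>j\<le>length l. ?W (take j (l @ [x]) @ m # drop j (l @ [x])))
      = (\<Sum>j\<le>length l. ?W (take j l @ m # drop j l) * ?v (s + m))"
      by (intro sum.cong) auto
    moreover have "?W (l @ [x, m]) = ?W l * (?v s * ?v (s + m))"
      by (simp add: path_denom_append fermat_inv_mult s_def)
    ultimately show ?thesis by simp
  qed
  also have "\<dots> = (\<Sum>j\<le>length l. ?W (take j l @ m # drop j l)) * ?v (s + m) + ?W l * (?v s * ?v (s + m))"
    by (simp add: sum_distrib_right)
  also have "[\<dots> = (?v m * ?W l + (\<Sum>q<length l. defect p m l q)) * ?v (s + m) + ?W l * (?v s * ?v (s + m))] (mod int p)"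
    by (intro cong_add cong_mult cong_refl snoc.IH)
  also have "(?v m * ?W l + (\<Sum>q<length l. defect p m l q)) * ?v (s + m) + ?W l * (?v s * ?v (s + m))
     = ?W l * (?v m * ?v (s + m) + ?v s * ?v (s + m)) + (\<Sum>q<length l. defect p m l q * ?v (s + m))"
    by (simp add: algebra_simps sum_distrib_left)
  also have "[\<dots> = ?W l * (?v m * ?v s + of_bool (p dvd s) * ?v m ^ 2 + of_bool (p dvd s + m) * ?v s ^ 2)
      + (\<Sum>q<length l. defect p m (l @ [x]) q)] (mod int p)"
    by (intro cong_add cong_mult cong_refl cong_sum fermat_inv_partial_fractions[OF p m])
       (simp add: cong_sym[OF defect_snoc] s_def)
  also have "?W l * (?v m * ?v s + of_bool (p dvd s) * ?v m ^ 2 + of_bool (p dvd s + m) * ?v s ^ 2)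
      + (\<Sum>q<length l. defect p m (l @ [x]) q)
     = ?v m * ?W (l @ [x]) + (\<Sum>q<length (l @ [x]). defect p m (l @ [x]) q)"
    by (simp add: defect_def[of p m "l @ [x]" "length l"] path_denom_append fermat_inv_mult
         power2_eq_square distrib_left mult_ac flip: s_def)
  finally show ?case .
qed

section \<open>Sums over tuples\<close>

definition tuples :: "nat \<Rightarrow> nat \<Rightarrow> nat list set" where
  "tuples p n = {l. length l = n \<and> set l \<subseteq> {0<..<p}}"

lemma tuples_0 [simp]: "tuples p 0 = {[]}"
  by (auto simp: tuples_def)

lemma finite_tuples [simp]: "finite (tuples p n)"
  unfolding tuples_def by (rule finite_subset[OF _ finite_lists_length_eq[of "{0<..<p}" n]]) auto

lemma sum_tuples_append:
  "(\<Sum>l\<in>tuples p (a + b). F l) = (\<Sum>u\<in>tuples p a. \<Sum>v\<in>tuples p b. F (u @ v))"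
  unfolding sum.cartesian_product
  by (rule sum.reindex_bij_witness[where i = "\<lambda>(u, v). u @ v" and j = "\<lambda>l. (take a l, drop a l)"])
     (auto simp: tuples_def dest: in_set_takeD in_set_dropD)

lemma sum_tuples_Suc:
  "(\<Sum>l\<in>tuples p (Suc n). F l) = (\<Sum>x\<in>{0<..<p}. \<Sum>v\<in>tuples p n. F (x # v))"
  unfolding sum.cartesian_product
  by (rule sum.reindex_bij_witness[where i = "\<lambda>(x, v). x # v" and j = "\<lambda>l. (hd l, tl l)"])
     (auto simp: tuples_def length_Suc_conv)

lemma sum_tuples_insert:
  assumes "j \<le> n"
  shows "(\<Sum>m\<in>{0<..<p}. \<Sum>l\<in>tuples p n. F (take j l @ m # drop j l)) = (\<Sum>l\<in>tuples p (Suc n). F l)"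
proof -
  have "(\<Sum>l\<in>tuples p n. F (take j l @ m # drop j l))
      = (\<Sum>u\<in>tuples p j. \<Sum>v\<in>tuples p (n - j). F (u @ m # v))" for m
  proof -
    have "(\<Sum>l\<in>tuples p n. F (take j l @ m # drop j l)) = (\<Sum>u\<in>tuples p j. \<Sum>v\<in>tuples p (n - j).
        F (take j (u @ v) @ m # drop j (u @ v)))"
      using sum_tuples_append[where a = j and b = "n - j" and F = "\<lambda>l. F (take j l @ m # drop j l)"] assms
      by simp
    also have "\<dots> = (\<Sum>u\<in>tuples p j. \<Sum>v\<in>tuples p (n - j). F (u @ m # v))"
      by (intro sum.cong refl) (auto simp: tuples_def)
    finally show ?thesis .
  qed
  then have "(\<Sum>m\<in>{0<..<p}. \<Sum>l\<in>tuples p n. F (take j l @ m # drop j l))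
      = (\<Sum>m\<in>{0<..<p}. \<Sum>u\<in>tuples p j. \<Sum>v\<in>tuples p (n - j). F (u @ m # v))"
    by simp
  also have "\<dots> = (\<Sum>u\<in>tuples p j. \<Sum>l\<in>tuples p (Suc (n - j)). F (u @ l))"
    unfolding sum_tuples_Suc by (rule sum.swap)
  also have "\<dots> = (\<Sum>l\<in>tuples p (Suc n). F l)"
    using sum_tuples_append[where F = F and p = p and a = j and b = "Suc (n - j)"] assms by simp
  finally show ?thesis .
qed

section \<open>Cutting paths at multiples of the prime\<close>

definition polylog_mod :: "nat \<Rightarrow> nat list \<Rightarrow> int poly" where
  "polylog_mod p k = (\<Sum>l\<in>tuples p (length k). monom (fermat_inv p (oy_denom k l)) (sum_list l))"

definition zeta_mod :: "nat \<Rightarrow> nat \<Rightarrow> nat list \<Rightarrow> int" where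
  "zeta_mod p i k = (\<Sum>l\<in>{l \<in> tuples p (length k). (i - 1) * p < sum_list l \<and> sum_list l < i * p}.
     fermat_inv p (oy_denom k l))"

lemma sum_list_tuples_le: "l \<in> tuples p n \<Longrightarrow> sum_list l \<le> n * p"
proof (induction l arbitrary: n)
  case (Cons x l)
  then obtain k where "n = Suc k" "l \<in> tuples p k" "x < p" by (cases n) (auto simp: tuples_def)
  then show ?case using Cons.IH[of k] by simp
qed simp

text \<open>
  A position \<open>s\<close> strictly between \<open>(i - 1)p\<close> and \<open>ip\<close> reaches a multiple of \<open>p\<close> by exactly one step
  smaller than \<open>p\<close>, namely \<open>ip - s\<close>; a multiple of \<open>p\<close> by none.
\<close>

lemma sum_monom_completion:
  assumes "p > 0" "s \<le> a * p"
  shows "(\<Sum>x\<in>{0<..<p}. of_bool (p dvd s + x) * monom c (s + x))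
    = (\<Sum>i = 1..a. if (i - 1) * p < s \<and> s < i * p then monom c (i * p) else (0 :: 'a :: comm_ring_1 poly))"
proof -
  have "(\<Sum>x\<in>{0<..<p}. of_bool (p dvd s + x) * monom c (s + x))
      = (\<Sum>x\<in>{x\<in>{0<..<p}. p dvd s + x}. monom c (s + x))"
    by (intro sum.mono_neutral_cong_right) auto
  also have "\<dots> = (\<Sum>i\<in>{i\<in>{1..a}. (i - 1) * p < s \<and> s < i * p}. monom c (i * p))"
  proof (rule sum.reindex_bij_witness[where j = "\<lambda>x. (s + x) div p" and i = "\<lambda>i. i * p - s"])
    fix x assume x: "x \<in> {x\<in>{0<..<p}. p dvd s + x}"
    then obtain i where i: "s + x = i * p" by (auto elim!: dvdE simp: mult.commute)
    then have d: "(s + x) div p = i" using assms(1) by simp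
    show "(s + x) div p * p - s = x" unfolding d using i by simp
    have "i \<noteq> 0" using i x by (intro notI) simp
    then obtain i' where i': "i = Suc i'" by (cases i) auto
    have "i' * p < s" "s < i * p" using i i' x by auto
    then have "i' * p < a * p" using assms(2) by linarith
    then have "i \<le> a" using i' by simp
    then show "(s + x) div p \<in> {i\<in>{1..a}. (i - 1) * p < s \<and> s < i * p}"
      unfolding d using \<open>i' * p < s\<close> \<open>s < i * p\<close> i' by simp
    show "monom c ((s + x) div p * p) = monom c (s + x)" unfolding d unfolding i ..
  next
    fix i assume i: "i \<in> {i\<in>{1..a}. (i - 1) * p < s \<and> s < i * p}"
    then have *: "s + (i * p - s) = i * p" by simp
    show "(s + (i * p - s)) div p = i" unfolding * using assms(1) by simp
    have "i * p = (i - 1) * p + p" using i by (cases i) auto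
    then have "i * p - s < p" using i by auto
    then show "i * p - s \<in> {x\<in>{0<..<p}. p dvd s + x}" using i by (simp add: *)
  qed
  also have "\<dots> = (\<Sum>i = 1..a. if (i - 1) * p < s \<and> s < i * p then monom c (i * p) else 0)"
    by (intro sum.mono_neutral_cong_left) auto
  finally show ?thesis .
qed

lemma sum_tuples_completion:
  assumes "p > 0" "length k = a"
  shows "(\<Sum>u\<in>tuples p a. \<Sum>x\<in>{0<..<p}. of_bool (p dvd sum_list u + x)
        * monom (fermat_inv p (oy_denom k u)) (sum_list u + x))
    = (\<Sum>i = 1..a. monom (zeta_mod p i k) (i * p))"
proof -
  have "(\<Sum>u\<in>tuples p a. \<Sum>x\<in>{0<..<p}. of_bool (p dvd sum_list u + x)
        * monom (fermat_inv p (oy_denom k u)) (sum_list u + x))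
      = (\<Sum>u\<in>tuples p a. \<Sum>i = 1..a. if (i - 1) * p < sum_list u \<and> sum_list u < i * p
           then monom (fermat_inv p (oy_denom k u)) (i * p) else 0)"
    using assms sum_list_tuples_le by (intro sum.cong refl sum_monom_completion) auto
  also have "\<dots> = (\<Sum>i = 1..a. \<Sum>u\<in>tuples p a. if (i - 1) * p < sum_list u \<and> sum_list u < i * p
           then monom (fermat_inv p (oy_denom k u)) (i * p) else 0)"
    by (rule sum.swap)
  also have "\<dots> = (\<Sum>i = 1..a. monom (zeta_mod p i k) (i * p))"
    by (intro sum.cong refl)
      (simp only: zeta_mod_def assms(2) monom_sum, rule sum.inter_filter[symmetric], simp)
  finally show ?thesis .
qed

lemma of_nat_dvd_sum_monom:
  assumes "\<And>x. x \<in> A \<Longrightarrow> [c x = c' x] (mod int p)"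
  shows "of_nat p dvd (\<Sum>x\<in>A. monom (c x) (d x)) - (\<Sum>x\<in>A. monom (c' x) (d x))"
proof -
  have "of_nat p dvd monom (c x) (d x) - monom (c' x) (d x)" if "x \<in> A" for x
  proof -
    from assms[OF that] obtain k where "c x - c' x = int p * k" by (auto simp: cong_iff_dvd_diff)
    then have "monom (c x) (d x) - monom (c' x) (d x) = of_nat p * monom k (d x)"
      by (simp add: diff_monom of_nat_mult_conv_smult smult_monom)
    then show ?thesis by simp
  qed
  then show ?thesis by (simp add: dvd_sum flip: sum_subtractf)
qed

lemma polylog_mod_ones:
  "polylog_mod p (replicate n 1) = (\<Sum>l\<in>tuples p n. monom (path_weight p 0 l) (sum_list l))"
  unfolding polylog_mod_def by (intro sum.cong) (auto simp: tuples_def oy_denom_ones[simplified])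

lemma polylog_mod_two_ones:
  "polylog_mod p (2 # replicate n 1) = (\<Sum>m\<in>{0<..<p}. \<Sum>l\<in>tuples p n.
     monom (fermat_inv p (m ^ 2) * path_weight p m l) (m + sum_list l))"
  unfolding polylog_mod_def
  by (simp add: sum_tuples_Suc del: replicate.simps, intro sum.cong refl)
     (auto simp: tuples_def oy_denom_two_ones[simplified] fermat_inv_mult)

text \<open>The inner sums in \<open>f\<^sub>n\<close> and \<open>g\<^sub>n\<close>.\<close>

definition zeta_poly_mod :: "nat \<Rightarrow> nat list \<Rightarrow> int poly" where
  "zeta_poly_mod p k = (\<Sum>i = 1..length k. monom (zeta_mod p i k) (i * p))"

text \<open>
  In both kinds of defect the condition on the tuple says that one step completes the first piece to
  a multiple of \<open>p\<close>: the inserted step \<open>m\<close> in the first kind, the step of \<open>l\<close> at position \<open>q\<close>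
  in the second. Everything else factors into the two pieces.
\<close>

lemma sum_defect:
  assumes p: "prime p" and q: "q < N"
  shows "(\<Sum>m\<in>{0<..<p}. \<Sum>l\<in>tuples p N. monom (defect p m l q) (m + sum_list l))
    = zeta_poly_mod p (replicate q 1 @ [2]) * polylog_mod p (replicate (N - Suc q) 1)
      + zeta_poly_mod p (replicate q 1) * polylog_mod p (2 # replicate (N - Suc q) 1)"
proof -
  let ?r = "N - Suc q"
  let ?A = "{0<..<p}"
  have ob: "monom (of_bool P * c) d = of_bool P * monom c d" for P and c :: int and d
    by (simp add: of_bool_def)
  have p0: "p > 0" using p by (simp add: prime_gt_0_nat)
  let ?f = "\<lambda>m u v. (of_bool (p dvd sum_list u + m)
        * monom (path_weight p 0 u * fermat_inv p (sum_list u)) (sum_list u + m))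
        * monom (path_weight p 0 v) (sum_list v)"
  have f: "(\<Sum>m\<in>?A. \<Sum>l\<in>tuples p N. of_bool (p dvd sum_list (take (Suc q) l) + m) *
       monom (path_weight p 0 (take (Suc q) l) * fermat_inv p (sum_list (take (Suc q) l))
          * path_weight p 0 (drop (Suc q) l)) (m + sum_list l))
    = zeta_poly_mod p (replicate q 1 @ [2]) * polylog_mod p (replicate ?r 1)" (is "?lhs = _")
  proof -
    have "?lhs = (\<Sum>m\<in>?A. \<Sum>u\<in>tuples p (Suc q). \<Sum>v\<in>tuples p ?r. ?f m u v)"
    proof (rule sum.cong[OF refl])
      fix m
      have N: "N = Suc q + ?r" using q by simp
      show "(\<Sum>l\<in>tuples p N. of_bool (p dvd sum_list (take (Suc q) l) + m) *
       monom (path_weight p 0 (take (Suc q) l) * fermat_inv p (sum_list (take (Suc q) l))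
          * path_weight p 0 (drop (Suc q) l)) (m + sum_list l))
        = (\<Sum>u\<in>tuples p (Suc q). \<Sum>v\<in>tuples p ?r. ?f m u v)"
        by (subst N, subst sum_tuples_append, intro sum.cong refl)
           (auto simp: tuples_def mult_monom ac_simps)
    qed
    also have "\<dots> = (\<Sum>u\<in>tuples p (Suc q). \<Sum>m\<in>?A. \<Sum>v\<in>tuples p ?r. ?f m u v)"
      by (rule sum.swap)
    also have "\<dots> = (\<Sum>u\<in>tuples p (Suc q). \<Sum>x\<in>?A. of_bool (p dvd sum_list u + x)
          * monom (path_weight p 0 u * fermat_inv p (sum_list u)) (sum_list u + x))
        * polylog_mod p (replicate ?r 1)"
      unfolding polylog_mod_ones sum_distrib_right unfolding sum_distrib_left ..
    also have "(\<Sum>u\<in>tuples p (Suc q). \<Sum>x\<in>?A. of_bool (p dvd sum_list u + x)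
          * monom (path_weight p 0 u * fermat_inv p (sum_list u)) (sum_list u + x))
        = zeta_poly_mod p (replicate q 1 @ [2])"
      unfolding zeta_poly_mod_def using sum_tuples_completion[OF p0, of "replicate q 1 @ [2]" "Suc q"]
      by (simp add: tuples_def oy_denom_ones_two[simplified] fermat_inv_mult)
    finally show ?thesis .
  qed
  let ?g = "\<lambda>m u x v. (of_bool (p dvd sum_list u + x)
        * monom (path_weight p 0 u) (sum_list u + x))
        * monom (fermat_inv p (m ^ 2) * path_weight p m v) (m + sum_list v)"
  have g: "(\<Sum>m\<in>?A. \<Sum>l\<in>tuples p N. of_bool (p dvd sum_list (take (Suc q) l)) *
       monom (path_weight p 0 (take q l) * (fermat_inv p (m ^ 2) * path_weight p m (drop (Suc q) l))) (m + sum_list l))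
    = zeta_poly_mod p (replicate q 1) * polylog_mod p (2 # replicate ?r 1)" (is "?lhs = _")
  proof -
    have "?lhs = (\<Sum>m\<in>?A. \<Sum>u\<in>tuples p q. \<Sum>x\<in>?A. \<Sum>v\<in>tuples p ?r. ?g m u x v)"
    proof (rule sum.cong[OF refl])
      fix m
      have N: "N = q + Suc ?r" using q by simp
      show "(\<Sum>l\<in>tuples p N. of_bool (p dvd sum_list (take (Suc q) l)) *
       monom (path_weight p 0 (take q l) * (fermat_inv p (m ^ 2) * path_weight p m (drop (Suc q) l))) (m + sum_list l))
        = (\<Sum>u\<in>tuples p q. \<Sum>x\<in>?A. \<Sum>v\<in>tuples p ?r. ?g m u x v)"
        by (subst N, subst sum_tuples_append, subst sum_tuples_Suc, intro sum.cong refl)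
           (auto simp: tuples_def mult_monom ac_simps)
    qed
    also have "\<dots> = (\<Sum>u\<in>tuples p q. \<Sum>m\<in>?A. \<Sum>x\<in>?A. \<Sum>v\<in>tuples p ?r. ?g m u x v)"
      by (rule sum.swap)
    also have "\<dots> = (\<Sum>u\<in>tuples p q. \<Sum>x\<in>?A. \<Sum>m\<in>?A. \<Sum>v\<in>tuples p ?r. ?g m u x v)"
      by (intro sum.cong refl sum.swap)
    also have "\<dots> = (\<Sum>u\<in>tuples p q. \<Sum>x\<in>?A. of_bool (p dvd sum_list u + x)
          * monom (path_weight p 0 u) (sum_list u + x))
        * polylog_mod p (2 # replicate ?r 1)"
      unfolding polylog_mod_two_ones sum_distrib_right unfolding sum_distrib_left ..
    also have "(\<Sum>u\<in>tuples p q. \<Sum>x\<in>?A. of_bool (p dvd sum_list u + x)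
          * monom (path_weight p 0 u) (sum_list u + x))
        = zeta_poly_mod p (replicate q 1)"
      unfolding zeta_poly_mod_def using sum_tuples_completion[OF p0, of "replicate q 1" "q"]
      by (simp add: tuples_def oy_denom_ones[simplified])
    finally show ?thesis .
  qed
  show ?thesis
    unfolding defect_def add_monom[symmetric] ob sum.distrib f g ..
qed

text \<open>
  Each tuple of length \<open>N + 1\<close> arises from exactly one insertion into each of the \<open>N + 1\<close>
  positions, whence the factor \<open>N + 1\<close>.
\<close>

lemma polylog_mod_ones_recurrence:
  assumes p: "prime p" "p \<ge> 3"
  shows "of_nat p dvd of_nat (Suc N) * polylog_mod p (replicate (Suc N) 1)
     - (polylog_mod p [1] * polylog_mod p (replicate N 1)
        + (\<Sum>q<N. zeta_poly_mod p (replicate q 1 @ [2]) * polylog_mod p (replicate (N - Suc q) 1)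
              + zeta_poly_mod p (replicate q 1) * polylog_mod p (2 # replicate (N - Suc q) 1)))"
proof -
  let ?X = "{0<..<p} \<times> tuples p N" and ?d = "\<lambda>(m, l). m + sum_list l"
  let ?W = "path_weight p 0"
  have "of_nat (Suc N) * polylog_mod p (replicate (Suc N) 1)
     = (\<Sum>j\<le>N. \<Sum>l\<in>tuples p (Suc N). monom (?W l) (sum_list l))"
    unfolding polylog_mod_ones by simp
  also have "\<dots> = (\<Sum>j\<le>N. \<Sum>m\<in>{0<..<p}. \<Sum>l\<in>tuples p N.
      monom (?W (take j l @ m # drop j l)) (sum_list (take j l @ m # drop j l)))"
    by (intro sum.cong refl sum_tuples_insert[symmetric]) simp
  also have "\<dots> = (\<Sum>j\<le>N. \<Sum>m\<in>{0<..<p}. \<Sum>l\<in>tuples p N. monom (?W (take j l @ m # drop j l)) (m + sum_list l))"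
  proof -
    have "sum_list (take j l @ m # drop j l) = m + sum_list l" for j m and l :: "nat list"
      by (metis (no_types, lifting) append_take_drop_id sum_list_append sum_list.Cons add.left_commute)
    then show ?thesis by (simp only:)
  qed
  also have "\<dots> = (\<Sum>(m, l)\<in>?X. \<Sum>j\<le>N. monom (?W (take j l @ m # drop j l)) (m + sum_list l))"
    by (simp only: sum.cartesian_product[symmetric], subst sum.swap, rule sum.cong[OF refl], rule sum.swap)
  also have "\<dots> = (\<Sum>z\<in>?X. monom (case z of (m, l) \<Rightarrow> \<Sum>j\<le>length l. ?W (take j l @ m # drop j l)) (?d z))"
    by (intro sum.cong refl) (auto simp: monom_sum tuples_def)
  finally have lhs: "of_nat (Suc N) * polylog_mod p (replicate (Suc N) 1) = \<dots>" .
  have "polylog_mod p [1] = (\<Sum>m\<in>{0<..<p}. monom (fermat_inv p m) m)"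
    using polylog_mod_ones[of p 1] by (simp add: sum_tuples_Suc)
  then have "polylog_mod p [1] * polylog_mod p (replicate N 1)
        + (\<Sum>q<N. zeta_poly_mod p (replicate q 1 @ [2]) * polylog_mod p (replicate (N - Suc q) 1)
              + zeta_poly_mod p (replicate q 1) * polylog_mod p (2 # replicate (N - Suc q) 1))
     = (\<Sum>m\<in>{0<..<p}. \<Sum>l\<in>tuples p N. monom (fermat_inv p m * ?W l) (m + sum_list l))
        + (\<Sum>q<N. \<Sum>m\<in>{0<..<p}. \<Sum>l\<in>tuples p N. monom (defect p m l q) (m + sum_list l))"
    unfolding polylog_mod_ones[of p N] by (simp add: sum_product mult_monom sum_defect[OF p(1)])
  also have "(\<Sum>q<N. \<Sum>m\<in>{0<..<p}. \<Sum>l\<in>tuples p N. monom (defect p m l q) (m + sum_list l))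
     = (\<Sum>m\<in>{0<..<p}. \<Sum>l\<in>tuples p N. \<Sum>q<N. monom (defect p m l q) (m + sum_list l))"
    by (subst sum.swap, rule sum.cong[OF refl], rule sum.swap)
  also have "(\<Sum>m\<in>{0<..<p}. \<Sum>l\<in>tuples p N. monom (fermat_inv p m * ?W l) (m + sum_list l)) + \<dots>
     = (\<Sum>m\<in>{0<..<p}. \<Sum>l\<in>tuples p N.
          monom (fermat_inv p m * ?W l + (\<Sum>q<length l. defect p m l q)) (m + sum_list l))"
    unfolding sum.distrib[symmetric]
    by (intro sum.cong refl) (auto simp: monom_sum tuples_def add_monom[symmetric])
  also have "\<dots> = (\<Sum>z\<in>?X. monom (case z of (m, l) \<Rightarrow>
      fermat_inv p m * ?W l + (\<Sum>q<length l. defect p m l q)) (?d z))"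
    by (simp add: sum.cartesian_product case_prod_unfold)
  finally show ?thesis
    unfolding lhs
    by (simp only:) (intro of_nat_dvd_sum_monom, auto intro!: sum_path_weight_insert[OF p] dest: nat_dvd_not_less)
qed

section \<open>The recurrence for almost all primes\<close>

lemma abs_large_mod_eqI:
  assumes "\<And>p. prime p \<Longrightarrow> p \<ge> 3 \<Longrightarrow> of_nat p dvd F p - G p"
  shows "abs_large_mod F = abs_large_mod G"
  unfolding large_mod.abs_eq_iff large_mod_rel_def
proof (rule finite_subset)
  show "{p. prime p \<and> \<not> of_nat p dvd F p - G p} \<subseteq> {..2}"
  proof clarify
    fix p assume "prime p" "\<not> of_nat p dvd F p - G p"
    then have "\<not> p \<ge> 3" using assms by blast
    then show "p \<le> 2" by simp
  qed
qed simp

lemma abs_large_mod_sum: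
  "finite A \<Longrightarrow> (\<Sum>x\<in>A. abs_large_mod (F x)) = abs_large_mod (\<lambda>p. \<Sum>x\<in>A. F x p)"
  by (induction A rule: finite_induct) (simp_all add: zero_large_mod.abs_eq plus_large_mod.abs_eq)

lemma modular_inverse_or_zero_cong_fermat_inv:
  assumes "prime p" "p \<ge> 3"
  shows "[(if coprime x p then modular_inverse (int p) (int x) else 0) = fermat_inv p x] (mod int p)"
proof (cases "coprime x p")
  case False
  then have "p dvd x" using assms(1) prime_imp_coprime coprime_commute by blast
  then show ?thesis using False assms(2) by (simp add: fermat_inv_eq_0 cong_sym)
next
  case True
  then show ?thesis
    using assms by (auto intro!: cong_sym[OF fermat_inv_unique] cong_modular_inverse1)
qed

lemma oy_range_conv_tuples: "oy_range k p = {l \<in> tuples p (length k). coprime (oy_denom k l) p}"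
  by (auto simp: oy_range_def tuples_def)

lemma oy_polylog_eq_abs: "oy_polylog k = abs_large_mod (\<lambda>p. polylog_mod p k)"
  unfolding oy_polylog.abs_eq
proof (rule abs_large_mod_eqI)
  fix p :: nat assume p: "prime p" "p \<ge> 3"
  have "(\<Sum>l\<in>oy_range k p. monom (modular_inverse (int p) (int (oy_denom k l))) (sum_list l))
    = (\<Sum>l\<in>tuples p (length k). monom (if coprime (oy_denom k l) p
        then modular_inverse (int p) (int (oy_denom k l)) else 0) (sum_list l))"
    unfolding oy_range_conv_tuples by (rule sum.mono_neutral_cong_left) auto
  then show "of_nat p dvd (\<Sum>l\<in>oy_range k p. monom (modular_inverse (int p) (int (oy_denom k l))) (sum_list l))
      - polylog_mod p k"
    unfolding polylog_mod_def
    by (simp only:) (intro of_nat_dvd_sum_monom modular_inverse_or_zero_cong_fermat_inv p)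
qed

lemma zeta_A_eq_abs: "zeta_A i k = abs_large_mod (\<lambda>p. zeta_mod p i k)"
  unfolding zeta_A.abs_eq
proof (rule abs_large_mod_eqI)
  fix p :: nat assume p: "prime p" "p \<ge> 3"
  let ?P = "\<lambda>l. (i - 1) * p < sum_list l \<and> sum_list l < i * p"
  have "(\<Sum>l\<in>{l \<in> oy_range k p. ?P l}. modular_inverse (int p) (int (oy_denom k l)))
    = (\<Sum>l\<in>{l \<in> tuples p (length k). ?P l}. if coprime (oy_denom k l) p
        then modular_inverse (int p) (int (oy_denom k l)) else 0)"
    unfolding oy_range_conv_tuples by (rule sum.mono_neutral_cong_left) auto
  moreover have "[(\<Sum>l\<in>{l \<in> tuples p (length k). ?P l}. if coprime (oy_denom k l) p
        then modular_inverse (int p) (int (oy_denom k l)) else 0) = zeta_mod p i k] (mod int p)"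
    unfolding zeta_mod_def by (intro cong_sum modular_inverse_or_zero_cong_fermat_inv p)
  ultimately show "of_nat p dvd (\<Sum>l\<in>{l \<in> oy_range k p. ?P l}. modular_inverse (int p) (int (oy_denom k l)))
      - zeta_mod p i k"
    by (simp add: cong_iff_dvd_diff)
qed

lemma zeta_poly_eq_abs:
  "(\<Sum>i = 1..length k. const_A (zeta_A i k) * t_pow_p i) = abs_large_mod (\<lambda>p. zeta_poly_mod p k)"
  by (simp add: zeta_A_eq_abs const_A.abs_eq t_pow_p.abs_eq times_large_mod.abs_eq abs_large_mod_sum
      zeta_poly_mod_def smult_monom)

lemma f_A_g_A_eq_abs:
  "f_A (Suc N) + g_A (Suc N) = abs_large_mod (\<lambda>p.
     \<Sum>q<N. zeta_poly_mod p (replicate q 1 @ [2]) * polylog_mod p (replicate (N - Suc q) 1)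
              + zeta_poly_mod p (replicate q 1) * polylog_mod p (2 # replicate (N - Suc q) 1))"
proof -
  have f: "f_A (Suc N) = (\<Sum>q<N. abs_large_mod (\<lambda>p.
     zeta_poly_mod p (replicate q 1 @ [2]) * polylog_mod p (replicate (N - Suc q) 1)))"
  proof -
    let ?F = "\<lambda>k. (\<Sum>i = 1..Suc N - k - 1. const_A (zeta_A i (replicate (Suc N - k - 2) 1 @ [2])) * t_pow_p i)
       * oy_polylog (replicate k 1)"
    \<comment> \<open>\<open>q = N - 1 - k\<close> is the length of the run of ones in the index of \<open>\<zeta>\<^bsup>(i)\<^esup>\<close>, for \<open>g_A\<close> as well.\<close>
    have "f_A (Suc N) = (\<Sum>q<N. ?F (N - Suc q))"
      unfolding f_A_def diff_Suc_1 by (rule sum.nat_diff_reindex[symmetric])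
    also have "\<dots> = (\<Sum>q<N. abs_large_mod (\<lambda>p.
     zeta_poly_mod p (replicate q 1 @ [2]) * polylog_mod p (replicate (N - Suc q) 1)))"
    proof (rule sum.cong[OF refl])
      fix q assume "q \<in> {..<N}"
      then have "Suc N - (N - Suc q) - 1 = length (replicate q (1::nat) @ [2])" "Suc N - (N - Suc q) - 2 = q" by auto
      then show "?F (N - Suc q) = abs_large_mod (\<lambda>p.
     zeta_poly_mod p (replicate q 1 @ [2]) * polylog_mod p (replicate (N - Suc q) 1))"
        by (simp only: zeta_poly_eq_abs oy_polylog_eq_abs times_large_mod.abs_eq)
    qed
    finally show ?thesis .
  qed
  have g: "g_A (Suc N) = (\<Sum>q<N. abs_large_mod (\<lambda>p.
     zeta_poly_mod p (replicate q 1) * polylog_mod p (2 # replicate (N - Suc q) 1)))"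
  proof -
    let ?F = "\<lambda>k. (\<Sum>i = 1..Suc N - k - 2. const_A (zeta_A i (replicate (Suc N - k - 2) 1)) * t_pow_p i)
       * oy_polylog (2 # replicate k 1)"
    have "g_A (Suc N) = (\<Sum>q<N. ?F (N - Suc q))"
      unfolding g_A_def diff_Suc_1 by (rule sum.nat_diff_reindex[symmetric])
    also have "\<dots> = (\<Sum>q<N. abs_large_mod (\<lambda>p.
     zeta_poly_mod p (replicate q 1) * polylog_mod p (2 # replicate (N - Suc q) 1)))"
    proof (rule sum.cong[OF refl])
      fix q assume "q \<in> {..<N}"
      then have *: "Suc N - (N - Suc q) - 2 = q" by auto
      show "?F (N - Suc q) = abs_large_mod (\<lambda>p.
     zeta_poly_mod p (replicate q 1) * polylog_mod p (2 # replicate (N - Suc q) 1))"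
        unfolding * using zeta_poly_eq_abs[of "replicate q 1"]
        by (simp only: length_replicate oy_polylog_eq_abs times_large_mod.abs_eq)
    qed
    finally show ?thesis .
  qed
  show ?thesis unfolding f g by (simp add: abs_large_mod_sum plus_large_mod.abs_eq sum.distrib)
qed

lemma of_nat_scaleQ_abs:
  fixes F :: "nat \<Rightarrow> 'a::comm_ring_1"
  shows "of_nat n *\<^sub>Q abs_large_mod F = abs_large_mod (\<lambda>p. of_nat n * F p)"
proof (induction n)
  case 0
  interpret vector_space "scaleQ :: _ \<Rightarrow> 'a large_mod \<Rightarrow> _" by (rule vector_space_scaleQ)
  show ?case by (simp add: zero_large_mod.abs_eq[symmetric])
next
  case (Suc n)
  then show ?case by (simp add: scaleQ_add_left scaleQ_one plus_large_mod.abs_eq algebra_simps)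
qed

lemma oy_polylog_ones_recurrence:
  "of_nat (Suc N) *\<^sub>Q oy_polylog (replicate (Suc N) 1)
     = oy_polylog [1] * oy_polylog (replicate N 1) + (f_A (Suc N) + g_A (Suc N))"
  unfolding f_A_g_A_eq_abs oy_polylog_eq_abs of_nat_scaleQ_abs times_large_mod.abs_eq plus_large_mod.abs_eq
  by (intro abs_large_mod_eqI polylog_mod_ones_recurrence)

lemma scaleQ_mult_right: "x * (q *\<^sub>Q y) = q *\<^sub>Q (x * y)"
  using scaleQ_mult_left[of q y x] by (simp add: mult.commute)

lemma fact_scaleQ_oy_polylog_ones:
  "fact n *\<^sub>Q oy_polylog (replicate n 1)
    = oy_polylog [1] ^ n + (\<Sum>k = 1..n. fact (k - 1) *\<^sub>Q ((f_A k + g_A k) * oy_polylog [1] ^ (n - k)))"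
proof (induction n)
  case 0
  show ?case by (simp add: oy_polylog_Nil scaleQ_one)
next
  case (Suc n)
  let ?X = "oy_polylog [1]" and ?h = "\<lambda>k. f_A k + g_A k"
  interpret vector_space "scaleQ :: _ \<Rightarrow> int poly large_mod \<Rightarrow> _" by (rule vector_space_scaleQ)
  have "(fact (Suc n) :: rat) = fact n * of_nat (Suc n)" by simp
  then have "fact (Suc n) *\<^sub>Q oy_polylog (replicate (Suc n) 1)
     = fact n *\<^sub>Q (?X * oy_polylog (replicate n 1) + ?h (Suc n))"
    by (simp only: scaleQ_assoc[symmetric] oy_polylog_ones_recurrence)
  also have "\<dots> = ?X * (fact n *\<^sub>Q oy_polylog (replicate n 1)) + fact n *\<^sub>Q ?h (Suc n)"
    by (simp add: scaleQ_add_right scaleQ_mult_right)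
  also have "\<dots> = ?X ^ Suc n + (\<Sum>k = 1..n. ?X * (fact (k - 1) *\<^sub>Q (?h k * ?X ^ (n - k)))) + fact n *\<^sub>Q ?h (Suc n)"
    unfolding Suc.IH by (simp add: distrib_left sum_distrib_left)
  also have "(\<Sum>k = 1..n. ?X * (fact (k - 1) *\<^sub>Q (?h k * ?X ^ (n - k))))
     = (\<Sum>k = 1..n. fact (k - 1) *\<^sub>Q (?h k * ?X ^ (Suc n - k)))"
    by (intro sum.cong refl) (auto simp: scaleQ_mult_right Suc_diff_le mult_ac)
  finally show ?case by (simp add: add.assoc)
qed

section \<open>The symmetry\<close>

lemma L_A_eq_power: "L_A n = (1 / fact n) *\<^sub>Q oy_polylog [1] ^ n"
proof -
  let ?S = "\<Sum>k = 1..n. fact (k - 1) *\<^sub>Q ((f_A k + g_A k) * oy_polylog [1] ^ (n - k))"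
  have "oy_polylog (replicate n 1) = (1 / fact n) *\<^sub>Q (fact n *\<^sub>Q oy_polylog (replicate n 1))"
    by (simp add: scaleQ_assoc scaleQ_one)
  also have "\<dots> = (1 / fact n) *\<^sub>Q oy_polylog [1] ^ n + (1 / fact n) *\<^sub>Q ?S"
    unfolding fact_scaleQ_oy_polylog_ones by (rule scaleQ_add_right)
  finally show ?thesis unfolding L_A_def by simp
qed

lemma subst_one_minus_mult: "subst_one_minus (x * y) = subst_one_minus x * subst_one_minus y"
  by transfer (simp add: pcompose_mult large_mod_rel_refl)

lemma subst_one_minus_one: "subst_one_minus 1 = 1"
  by transfer (simp add: pcompose_1 large_mod_rel_refl)

lemma subst_one_minus_power: "subst_one_minus (x ^ n) = subst_one_minus x ^ n"
  by (induction n) (simp_all add: subst_one_minus_one subst_one_minus_mult)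

lemma subst_one_minus_scaleQ: "subst_one_minus (q *\<^sub>Q x) = q *\<^sub>Q subst_one_minus x"
  by transfer (simp add: of_int_poly pcompose_smult large_mod_rel_refl)

text \<open>
  The polynomial \<open>(1 - t\<^sup>p - (1 - t)\<^sup>p) / p\<close>, for odd primes \<open>p\<close>, in expanded form, where the
  division by \<open>p\<close> takes place in the binomial coefficients.
\<close>

definition fermat_quotient_poly :: "nat \<Rightarrow> int poly" where
  "fermat_quotient_poly p = (\<Sum>x\<in>{0<..<p}. monom ((- 1) ^ (x - 1) * int ((p choose x) div p)) x)"

lemma of_nat_mult_fermat_quotient_poly:
  assumes p: "prime p" "p \<ge> 3"
  shows "of_nat p * fermat_quotient_poly p = 1 - monom 1 1 ^ p - (1 - monom 1 1) ^ p"
proof -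
  have odd: "odd p" using p prime_odd_nat by auto
  have "(1 - monom 1 1) ^ p = (- monom 1 1 + 1 :: int poly) ^ p" by simp
  also have "\<dots> = (\<Sum>x\<le>p. of_nat (p choose x) * (- monom 1 1) ^ x)"
    by (subst binomial_ring) simp
  also have "{..p} = insert 0 (insert p {0<..<p})" using p by auto
  also have "(\<Sum>x\<in>\<dots>. of_nat (p choose x) * (- monom 1 1) ^ x)
     = 1 - monom 1 1 ^ p + (\<Sum>x\<in>{0<..<p}. of_nat (p choose x) * (- monom 1 1 :: int poly) ^ x)"
    using p odd by simp
  also have "(\<Sum>x\<in>{0<..<p}. of_nat (p choose x) * (- monom 1 1 :: int poly) ^ x) = - (of_nat p * fermat_quotient_poly p)"
    unfolding fermat_quotient_poly_def sum_distrib_left sum_negf[symmetric]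
  proof (rule sum.cong[OF refl])
    fix x assume x: "x \<in> {0<..<p}"
    then have "p dvd p choose x" using p by (intro dvd_choose_prime) auto
    then have c: "int p * int ((p choose x) div p) = int (p choose x)" by (simp flip: of_nat_mult)
    obtain y where y: "x = Suc y" using x by (cases x) auto
    have m: "(- monom 1 1 :: int poly) ^ x = monom ((- 1) ^ x) x"
      by (simp add: minus_monom monom_power)
    show "of_nat (p choose x) * (- monom 1 1) ^ x
       = - (of_nat p * monom ((- 1) ^ (x - 1) * int ((p choose x) div p)) x)"
      unfolding m using c
      by (simp add: of_nat_mult_conv_smult smult_monom minus_monom y mult.left_commute)
  qed
  finally show ?thesis by simp
qed

lemma pcompose_power: "(f ^ n) \<circ>\<^sub>p g = (f \<circ>\<^sub>p g :: 'a::comm_semiring_1 poly) ^ n"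
  by (induction n) (simp_all add: pcompose_1 pcompose_mult)

text \<open>
  The right-hand side of \<open>of_nat_mult_fermat_quotient_poly\<close> is visibly symmetric, and multiplication
  by \<open>p\<close> is injective on integer polynomials.
\<close>

lemma fermat_quotient_poly_symmetric:
  assumes p: "prime p" "p \<ge> 3"
  shows "fermat_quotient_poly p \<circ>\<^sub>p [:1, -1:] = fermat_quotient_poly p"
proof -
  let ?H = "fermat_quotient_poly p"
  have x: "monom 1 1 \<circ>\<^sub>p [:1, -1:] = (1 - monom 1 1 :: int poly)"
    by (simp add: monom_altdef pcompose_pCons one_pCons)
  have "of_nat p * (?H \<circ>\<^sub>p [:1, -1:]) = (of_nat p * ?H) \<circ>\<^sub>p [:1, -1:]"
    by (simp add: of_nat_mult_conv_smult pcompose_smult)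
  also have "\<dots> = of_nat p * ?H"
    unfolding of_nat_mult_fermat_quotient_poly[OF p]
    by (simp only: pcompose_diff pcompose_power pcompose_1 x, simp)
  finally show ?thesis using p(2) by simp
qed

lemma prime_choose_pred_cong:
  assumes "prime p" "x < p"
  shows "[int ((p - 1) choose x) = (- 1) ^ x] (mod int p)"
  using assms(2)
proof (induction x)
  case (Suc x)
  have "p choose Suc x = ((p - 1) choose x) + ((p - 1) choose Suc x)"
    using prime_gt_0_nat[OF assms(1)] by (cases p) auto
  moreover have "p dvd p choose Suc x" using assms(1) Suc.prems by (intro dvd_choose_prime) auto
  ultimately have "[int ((p - 1) choose Suc x) = - int ((p - 1) choose x)] (mod int p)"
    by (simp add: cong_iff_dvd_diff add.commute flip: of_nat_add)
  also have "[- int ((p - 1) choose x) = - ((- 1) ^ x)] (mod int p)"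
    using Suc by (intro cong_minus_minus_iff[THEN iffD2]) auto
  finally show ?case by simp
qed simp

text \<open>
  From \<open>x \<cdot> (p choose x) = p \<cdot> ((p - 1) choose (x - 1))\<close>, after cancelling \<open>p\<close>, and
  \<open>(p - 1) choose (x - 1) \<equiv> (-1)\<^bsup>x - 1\<^esup>\<close>.
\<close>

lemma fermat_inv_conv_choose:
  assumes p: "prime p" "p \<ge> 3" and x: "x \<in> {0<..<p}"
  shows "[fermat_inv p x = (- 1) ^ (x - 1) * int ((p choose x) div p)] (mod int p)"
proof (rule fermat_inv_unique[OF p])
  have "p dvd p choose x" using p x by (intro dvd_choose_prime) auto
  moreover have "x * (p choose x) = p * ((p - 1) choose (x - 1))"
    using Suc_times_binomial[of "x - 1" "p - 1"] p x by (cases p; cases x) simp_all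
  ultimately have "x * ((p choose x) div p) = (p - 1) choose (x - 1)"
    using p by (auto elim!: dvdE)
  then have "int x * ((- 1) ^ (x - 1) * int ((p choose x) div p)) = (- 1) ^ (x - 1) * int ((p - 1) choose (x - 1))"
    by (metis mult.left_commute of_nat_mult)
  moreover have "[(- 1) ^ (x - 1) * int ((p - 1) choose (x - 1)) = (- 1) ^ (x - 1) * (- 1) ^ (x - 1)] (mod int p)"
    using x p by (intro cong_mult cong_refl prime_choose_pred_cong) auto
  moreover have "(- 1) ^ (x - 1) * (- 1) ^ (x - 1) = (1 :: int)" by (simp flip: power_mult_distrib)
  ultimately show "[int x * ((- 1) ^ (x - 1) * int ((p choose x) div p)) = 1] (mod int p)"
    by (simp only:)
qed

lemma oy_polylog_1_eq_abs: "oy_polylog [1] = abs_large_mod fermat_quotient_poly"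
  unfolding oy_polylog_eq_abs
proof (rule abs_large_mod_eqI)
  fix p :: nat assume p: "prime p" "p \<ge> 3"
  have "polylog_mod p [1] = (\<Sum>x\<in>{0<..<p}. monom (fermat_inv p x) x)"
    using polylog_mod_ones[of p 1] by (simp add: sum_tuples_Suc)
  then show "of_nat p dvd polylog_mod p [1] - fermat_quotient_poly p"
    unfolding fermat_quotient_poly_def
    by (simp only:) (intro of_nat_dvd_sum_monom fermat_inv_conv_choose p)
qed

lemma subst_one_minus_oy_polylog_1: "subst_one_minus (oy_polylog [1]) = oy_polylog [1]"
  unfolding oy_polylog_1_eq_abs subst_one_minus.abs_eq
  by (rule abs_large_mod_eqI) (simp add: fermat_quotient_poly_symmetric)

theorem corollary1p4:
  fixes n :: nat
  assumes "n \<ge> 1"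
  shows "L_A n = subst_one_minus (L_A n)"
  unfolding L_A_eq_power subst_one_minus_scaleQ subst_one_minus_power subst_one_minus_oy_polylog_1 ..

end
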